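(* Let $(W,\mathcal{M})$ be a finite social decision frame. If $(W,\mathcal{M})$ is coherent, then it is measurable.
   Context: A finite social decision frame is a pair $(W,\mathcal{M})$ where $W$ is a nonempty finite set and $\mathcal{M}$ is a family of subsets of $W$. Put $A^c=W\setminus A$ and $\mathcal{H}=\{A\subseteq W: A\notin\mathcal{M}\text{ and }A^c\notin\mathcal{M}\}$. The frame is measurable if there is a finitely additive set function $\mu$ on all subsets of $W$, with values in the natural numbers, $\mu(\varnothing)=0$ and $\mu(\{w\})>0$ for every $w\in W$, such that for every $A\subseteq W$: $A\in\mathcal{M}$ if and only if $\mu(A)>\frac12\mu(W)$. The frame is coherent if for every positive integer $n$ and every sequence $A_1,\dots,A_n$ of subsets of $W$ (repetitions allowed): if (c1) $A_i\in\mathcal{M}\cup\mathcal{H}$ for all $i$, and (c2) every $w\in W$ satisfies $|\{i\le n: w\in A_i\}|\le n/2$; then (c3) $A_i\in\mathcal{H}$ for all $i$, and (c4) every $w\in W$ satisfies $|\{i\le n: w\in A_i\}|= n/2$. *)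

theory Defs
  imports "HOL-Analysis.Analysis"
begin

definition social_decision_frame :: "'a set \<Rightarrow> 'a set set \<Rightarrow> bool" where
  "social_decision_frame W M \<longleftrightarrow> finite W \<and> W \<noteq> {} \<and> M \<subseteq> Pow W"

definition blocking :: "'a set \<Rightarrow> 'a set set \<Rightarrow> 'a set set" where
  "blocking W M = {A. A \<subseteq> W \<and> A \<notin> M \<and> W - A \<notin> M}"

(* Only the values of \<mu> on subsets of W are constrained;
   additive (Pow W) \<mu> is the library's additivity on disjoint pairs. *)
definition measurable_frame :: "'a set \<Rightarrow> 'a set set \<Rightarrow> bool" where
  "measurable_frame W M \<longleftrightarrow>
     (\<exists>\<mu> :: 'a set \<Rightarrow> nat.
        additive (Pow W) \<mu> \<and> \<mu> {} = 0 \<and> (\<forall>w\<in>W. \<mu> {w} > 0) \<and>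
        (\<forall>A. A \<subseteq> W \<longrightarrow> (A \<in> M \<longleftrightarrow> real (\<mu> A) > 1 / 2 * real (\<mu> W))))"

definition coherent_frame :: "'a set \<Rightarrow> 'a set set \<Rightarrow> bool" where
  "coherent_frame W M \<longleftrightarrow>
     (\<forall>(n::nat) (A :: nat \<Rightarrow> 'a set).
        n \<ge> 1 \<longrightarrow>
        (\<forall>i\<in>{1..n}. A i \<subseteq> W) \<longrightarrow>
        (\<forall>i\<in>{1..n}. A i \<in> M \<union> blocking W M) \<longrightarrow>
        (\<forall>w\<in>W. real (card {i\<in>{1..n}. w \<in> A i}) \<le> real n / 2) \<longrightarrow>
        (\<forall>i\<in>{1..n}. A i \<in> blocking W M) \<and>
        (\<forall>w\<in>W. real (card {i\<in>{1..n}. w \<in> A i}) = real n / 2))"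

end

theory Submission
  imports Defs
begin

text \<open>
  Write \<open>v\<^sub>A = 1\<^sub>A - 1\<^sub>W\<^sub>-\<^sub>A\<close>. A measure as required is a rational solution \<open>x\<close> of the system
  \<open>v\<^sub>A \<bullet> x > 0\<close> for \<open>A \<in> M\<close>, \<open>v\<^sub>A \<bullet> x \<ge> 0\<close> for blocking \<open>A\<close>, and \<open>x\<^sub>w > 0\<close> for \<open>w \<in> W\<close>, with
  denominators cleared. By Motzkin's transposition theorem an unsolvable system admits a
  nonnegative integer combination of its constraints that reads \<open>0 > 0\<close>. The sets \<open>A\<close> that occur
  in it, listed with multiplicity, form a sequence satisfying (c1) and (c2); since a strict
  constraint takes part, (c3) or (c4) fails. The transposition theorem is proved by
  Fourier--Motzkin elimination, which never leaves the additive semigroup generated by the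
  constraints.
\<close>

section \<open>Motzkin's transposition theorem\<close>

text \<open>A pair \<open>(a, s)\<close> stands for the constraint \<open>a \<bullet> x \<ge> 0\<close>, strict if \<open>s\<close> holds.\<close>

inductive_set consequences :: "(('a \<Rightarrow> int) \<times> bool) set \<Rightarrow> (('a \<Rightarrow> int) \<times> bool) set"
  for S :: "(('a \<Rightarrow> int) \<times> bool) set" where
  base: "p \<in> S \<Longrightarrow> p \<in> consequences S"
| add: "(a, s) \<in> consequences S \<Longrightarrow> (b, t) \<in> consequences S \<Longrightarrow>
    (\<lambda>w. a w + b w, s \<or> t) \<in> consequences S"

definition satisfies :: "'a set \<Rightarrow> ('a \<Rightarrow> rat) \<Rightarrow> ('a \<Rightarrow> int) \<times> bool \<Rightarrow> bool" where
  "satisfies W x p \<longleftrightarrow>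
     (if snd p then (\<Sum>w\<in>W. of_int (fst p w) * x w) > 0
      else (\<Sum>w\<in>W. of_int (fst p w) * x w) \<ge> 0)"

lemma consequences_scale:
  assumes "(a, s) \<in> consequences S" "k > 0"
  shows "(\<lambda>w. k * a w, s) \<in> consequences S"
proof -
  \<comment> \<open>The induction starts at multiplier 1, since closure under sums supplies no zero
    combination.\<close>
  have "(\<lambda>w. int (Suc n) * a w, s) \<in> consequences S" for n
  proof (induction n)
    case 0
    then show ?case using assms(1) by simp
  next
    case (Suc n)
    from consequences.add[OF Suc assms(1)] show ?case
      by (simp add: algebra_simps)
  qed
  from this[of "nat k - 1"] assms(2) show ?thesis by simp
qed

lemma consequences_subset:
  assumes "p \<in> consequences T" "T \<subseteq> consequences S"
  shows "p \<in> consequences S"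
  using assms by (induction rule: consequences.induct) (auto intro: consequences.intros)

lemma consequences_vanish:
  assumes "p \<in> consequences T" "\<And>q. q \<in> T \<Longrightarrow> fst q w = 0"
  shows "fst p w = 0"
  using assms by (induction rule: consequences.induct) auto

text \<open>Back substitution in the elimination: \<open>y\<close> will be the value of the
  eliminated variable, \<open>l\<close> and \<open>u\<close> its lower and upper bounds.\<close>

lemma between_finite_bounds:
  fixes l u :: "'b \<Rightarrow> 'c :: linordered_field"
  assumes "finite P" "finite N"
    and le: "\<And>p q. p \<in> P \<Longrightarrow> q \<in> N \<Longrightarrow> l p \<le> u q"
    and less: "\<And>p q. p \<in> P \<Longrightarrow> q \<in> N \<Longrightarrow> s p \<or> s q \<Longrightarrow> l p < u q"
  obtains y where "\<And>p. p \<in> P \<Longrightarrow> l p \<le> y \<and> (s p \<longrightarrow> l p < y)"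
    and "\<And>q. q \<in> N \<Longrightarrow> y \<le> u q \<and> (s q \<longrightarrow> y < u q)"
proof -
  consider "P = {}" "N = {}" | "P \<noteq> {}" "N = {}" | "P = {}" "N \<noteq> {}" | "P \<noteq> {}" "N \<noteq> {}"
    by blast
  then show thesis
  proof cases
    case 1
    then show ?thesis using that by blast
  next
    case 2
    have "l p < Max (l ` P) + 1" if "p \<in> P" for p
      using that assms(1) by (meson Max_ge finite_imageI imageI le_less_trans less_add_one)
    then show ?thesis using that[of "Max (l ` P) + 1"] 2 by force
  next
    case 3
    have "Min (u ` N) - 1 < u q" if "q \<in> N" for q
      using that assms(2)
      by (meson Min_le diff_less_eq finite_imageI imageI le_less_trans less_add_one)
    then show ?thesis using that[of "Min (u ` N) - 1"] 3 by force
  next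
    case 4
    have "Max (l ` P) \<in> l ` P" "Min (u ` N) \<in> u ` N" using assms(1,2) 4 by simp_all
    then obtain p0 q0 where "p0 \<in> P" "l p0 = Max (l ` P)" "q0 \<in> N" "u q0 = Min (u ` N)"
      by (metis imageE)
    with assms(1,2) have p0: "p0 \<in> P" "\<And>p. p \<in> P \<Longrightarrow> l p \<le> l p0"
      and q0: "q0 \<in> N" "\<And>q. q \<in> N \<Longrightarrow> u q0 \<le> u q" by simp_all
    have lu: "l p0 \<le> u q0" using le p0 q0 by blast
    \<comment> \<open>The midpoint respects strict bounds as well: for strict \<open>p\<close>,
      adding \<open>l p \<le> l p0\<close> and \<open>l p < u q0\<close> gives a strict inequality;
      the case of \<open>q\<close> is symmetric.\<close>
    show ?thesis
    proof (rule that[of "(l p0 + u q0) / 2"])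
      fix p assume p: "p \<in> P"
      then show "l p \<le> (l p0 + u q0) / 2 \<and> (s p \<longrightarrow> l p < (l p0 + u q0) / 2)"
        using p0(2)[OF p] le[OF p q0(1)] less[OF p q0(1)] by (auto simp: field_simps)
    next
      fix q assume q: "q \<in> N"
      then show "(l p0 + u q0) / 2 \<le> u q \<and> (s q \<longrightarrow> (l p0 + u q0) / 2 < u q)"
        using q0(2)[OF q] le[OF p0(1) q] less[OF p0(1) q] by (auto simp: field_simps)
    qed
  qed
qed

theorem motzkin_transposition:
  assumes "finite W" "finite S"
    and "\<And>a. (a, True) \<in> consequences S \<Longrightarrow> \<exists>w\<in>W. a w \<noteq> 0"
  shows "\<exists>x. \<forall>p\<in>S. satisfies W x p"
  using assms
proof (induction W arbitrary: S rule: finite_induct)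
  case empty
  \<comment> \<open>Every sum over no variables is 0, so only a strict constraint can fail, and that
    would itself be a contradictory consequence.\<close>
  have "\<not> snd p" if "p \<in> S" for p
    using empty(2)[of "fst p"] consequences.base[OF that] by (cases p) auto
  then show ?case by (auto simp: satisfies_def)
next
  case (insert w W)
  define P where "P = {p \<in> S. fst p w > 0}"
  define N where "N = {p \<in> S. fst p w < 0}"
  \<comment> \<open>The multipliers \<open>- fst q w\<close> and \<open>fst p w\<close> are positive
    integers on \<open>P\<close> and \<open>N\<close> and cancel the coefficient of
    \<open>w\<close>.\<close>
  define elim where "elim = (\<lambda>(p :: ('a \<Rightarrow> int) \<times> bool, q :: ('a \<Rightarrow> int) \<times> bool).
      (\<lambda>v. - fst q w * fst p v + fst p w * fst q v, snd p \<or> snd q))"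
  define T where "T = {p \<in> S. fst p w = 0} \<union> elim ` (P \<times> N)"
  have fin: "finite P" "finite N" "finite T"
    using insert.prems(1) by (auto simp: P_def N_def T_def)
  have sub: "T \<subseteq> consequences S"
  proof -
    have "elim (p, q) \<in> consequences S" if "p \<in> P" "q \<in> N" for p q
    proof -
      obtain a s b t where pq: "p = (a, s)" "q = (b, t)" by (cases p, cases q)
      have "(a, s) \<in> consequences S" "(b, t) \<in> consequences S" "a w > 0" "- b w > 0"
        using that by (auto simp: P_def N_def pq intro: consequences.base)
      from consequences.add[OF consequences_scale[OF this(1,4)] consequences_scale[OF this(2,3)]]
      show ?thesis by (simp add: elim_def pq)
    qed
    then show ?thesis by (auto simp: T_def intro: consequences.base)
  qed
  have van: "fst p w = 0" if "p \<in> T" for p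
    using that by (auto simp: T_def elim_def)
  \<comment> \<open>A strict consequence of \<open>T\<close> is one of \<open>S\<close>, hence
    nonzero somewhere on \<open>insert w W\<close>, but its coefficient at \<open>w\<close> is
    0.\<close>
  have "\<exists>v\<in>W. a v \<noteq> 0" if "(a, True) \<in> consequences T" for a
    using insert.prems(2)[OF consequences_subset[OF that sub]]
      consequences_vanish[OF that van] by auto
  from insert.IH[OF fin(3) this] obtain x where x: "\<And>p. p \<in> T \<Longrightarrow> satisfies W x p"
    by blast
  define f where "f p = (\<Sum>v\<in>W. of_int (fst p v) * x v)" for p :: "('a \<Rightarrow> int) \<times> bool"
  \<comment> \<open>The value of the variable \<open>w\<close> that turns \<open>p\<close> into an
    equality: a lower bound for \<open>p\<close> in \<open>P\<close>, an upper bound for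
    \<open>p\<close> in \<open>N\<close>.\<close>
  define r where "r p = - f p / of_int (fst p w)" for p
  have f_elim: "f (elim (p, q)) = of_int (- fst q w) * f p + of_int (fst p w) * f q" for p q
    by (simp add: f_def elim_def sum_distrib_left algebra_simps sum.distrib sum_subtractf
        sum_negf)
  have cross: "r p \<le> r q \<and> (snd p \<or> snd q \<longrightarrow> r p < r q)" if "p \<in> P" "q \<in> N" for p q
  proof -
    have "elim (p, q) \<in> T" using that by (auto simp: T_def)
    from x[OF this] have "f (elim (p, q)) \<ge> 0 \<and> (snd p \<or> snd q \<longrightarrow> f (elim (p, q)) > 0)"
      by (auto simp: satisfies_def f_def elim_def split: if_splits)
    moreover have "of_int (fst p w) > (0::rat)" "of_int (fst q w) < (0::rat)"
      using that by (auto simp: P_def N_def)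
    ultimately show ?thesis unfolding f_elim r_def by (auto simp: field_simps)
  qed
  obtain y where y: "\<And>p. p \<in> P \<Longrightarrow> r p \<le> y \<and> (snd p \<longrightarrow> r p < y)"
      "\<And>q. q \<in> N \<Longrightarrow> y \<le> r q \<and> (snd q \<longrightarrow> y < r q)"
    using between_finite_bounds[of P N r r snd] fin cross by (metis (no_types, lifting))
  define z where "z = x(w := y)"
  have fz: "(\<Sum>v\<in>insert w W. of_int (fst p v) * z v) = of_int (fst p w) * y + f p" for p
  proof -
    have "(\<Sum>v\<in>W. of_int (fst p v) * z v) = f p"
      unfolding f_def z_def using insert.hyps by (intro sum.cong) auto
    then show ?thesis using insert.hyps by (simp add: z_def)
  qed
  have "satisfies (insert w W) z p" if p: "p \<in> S" for p
  proof -
    consider "fst p w = 0" | "p \<in> P" | "p \<in> N"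
      using p by (force simp: P_def N_def)
    then show ?thesis
    proof cases
      case 1
      then have "satisfies W x p" using p x by (auto simp: T_def)
      with 1 show ?thesis by (simp add: satisfies_def fz[unfolded f_def] f_def)
    next
      case 2
      then have "of_int (fst p w) > (0::rat)" by (simp add: P_def)
      with y(1)[OF 2] show ?thesis unfolding satisfies_def fz r_def by (auto simp: field_simps)
    next
      case 3
      then have "of_int (fst p w) < (0::rat)" by (simp add: N_def)
      with y(2)[OF 3] show ?thesis unfolding satisfies_def fz r_def by (auto simp: field_simps)
    qed
  qed
  then show ?case by blast
qed

section \<open>Clearing denominators\<close>

lemma common_denominator:
  fixes x :: "'a \<Rightarrow> rat"
  assumes "finite W"
  obtains k :: nat where "k > 0" "\<And>w. w \<in> W \<Longrightarrow> of_nat k * x w \<in> \<int>"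
proof -
  have "\<exists>k::nat. k > 0 \<and> (\<forall>w\<in>W. of_nat k * x w \<in> \<int>)"
    using assms
  proof (induction W rule: finite_induct)
    case empty
    then show ?case by auto
  next
    case (insert w W)
    then obtain k :: nat where k: "k > 0" "\<And>v. v \<in> W \<Longrightarrow> of_nat k * x v \<in> \<int>" by blast
    obtain a b where ab: "x w = of_int a / of_int b" "b > 0"
      by (metis Rat_cases Fract_of_int_quotient)
    have "of_nat (k * nat b) * x v \<in> \<int>" if v: "v \<in> insert w W" for v
    proof (cases "v = w")
      case True
      have "of_nat (k * nat b) * x w = of_int (int k * a)" using ab by simp
      then show ?thesis using True by (metis Ints_of_int)
    next
      case False
      have "of_nat (k * nat b) * x v = of_int b * (of_nat k * x v)" using ab(2) by simp
      then show ?thesis using k(2)[of v] v False by (metis Ints_mult Ints_of_int insertE)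
    qed
    moreover have "k * nat b > 0" using k(1) ab(2) by simp
    ultimately show ?case by blast
  qed
  then show ?thesis using that by blast
qed

section \<open>Coherent frames\<close>

text \<open>Paired with a weight function on \<open>W\<close>, this vector gives the weight of
  \<open>A\<close> minus that of its complement.\<close>

definition side :: "'a set \<Rightarrow> 'a \<Rightarrow> int" where
  "side A w = (if w \<in> A then 1 else - 1)"

definition frame_constraints :: "'a set \<Rightarrow> 'a set set \<Rightarrow> (('a \<Rightarrow> int) \<times> bool) set" where
  "frame_constraints W M =
     (\<lambda>A. (side A, A \<in> M)) ` (M \<union> blocking W M) \<union> (\<lambda>w. (\<lambda>v. of_bool (v = w), True)) ` W"

text \<open>Translates (c2) and (c4): the sum is at most 0, or equal to 0, exactly if
  \<open>w\<close> lies in at most, or exactly, half of the listed sets.\<close>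

lemma sum_list_side:
  "(\<Sum>A\<leftarrow>L. side A w) = 2 * int (length (filter (\<lambda>A. w \<in> A) L)) - int (length L)"
  by (induction L) (auto simp: side_def)

text \<open>Lists count positions from 0, the sequences in the definition of coherence from
  1.\<close>

lemma card_positions_shifted:
  "card {i\<in>{1..length L}. P (L ! (i - 1))} = length (filter P L)"
proof -
  have "{i\<in>{1..length L}. P (L ! (i - 1))} = Suc ` {i. i < length L \<and> P (L ! i)}"
  proof (intro equalityI subsetI)
    fix i assume "i \<in> {i\<in>{1..length L}. P (L ! (i - 1))}"
    then show "i \<in> Suc ` {i. i < length L \<and> P (L ! i)}"
      by (intro image_eqI[of _ _ "i - 1"]) auto
  qed auto
  then show ?thesis by (simp add: length_filter_conv_card card_image)
qed

lemma coherent_list: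
  assumes "social_decision_frame W M" "coherent_frame W M" "L \<noteq> []"
    and L: "set L \<subseteq> M \<union> blocking W M"
    and le: "\<And>w. w \<in> W \<Longrightarrow> (\<Sum>A\<leftarrow>L. side A w) \<le> 0"
  shows "set L \<subseteq> blocking W M" and "\<And>w. w \<in> W \<Longrightarrow> (\<Sum>A\<leftarrow>L. side A w) = 0"
proof -
  define A where "A i = L ! (i - 1)" for i
  define n where "n = length L"
  have card: "card {i\<in>{1..n}. w \<in> A i} = length (filter (\<lambda>A. w \<in> A) L)" for w
    unfolding A_def n_def by (rule card_positions_shifted)
  have in_L: "A i \<in> set L" if "i \<in> {1..n}" for i
    using that by (auto simp: A_def n_def)
  have sub: "B \<subseteq> W" if "B \<in> M \<union> blocking W M" for B
    using that assms(1) by (auto simp: social_decision_frame_def blocking_def)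
  have "n \<ge> 1" using assms(3) by (cases L) (auto simp: n_def)
  moreover have "\<forall>i\<in>{1..n}. A i \<subseteq> W" "\<forall>i\<in>{1..n}. A i \<in> M \<union> blocking W M"
    using in_L L sub by blast+
  moreover have "\<forall>w\<in>W. real (card {i\<in>{1..n}. w \<in> A i}) \<le> real n / 2"
  proof
    fix w assume "w \<in> W"
    from le[OF this] show "real (card {i\<in>{1..n}. w \<in> A i}) \<le> real n / 2"
      unfolding card unfolding sum_list_side n_def by linarith
  qed
  ultimately have *: "\<forall>i\<in>{1..n}. A i \<in> blocking W M"
      "\<forall>w\<in>W. real (card {i\<in>{1..n}. w \<in> A i}) = real n / 2"
    using assms(2) unfolding coherent_frame_def by blast+
  show "set L \<subseteq> blocking W M"
  proof
    fix B assume "B \<in> set L"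
    then obtain i where "i < n" "B = A (Suc i)" by (auto simp: in_set_conv_nth A_def n_def)
    then show "B \<in> blocking W M" using *(1) by auto
  qed
  show "(\<Sum>A\<leftarrow>L. side A w) = 0" if "w \<in> W" for w
  proof -
    have "real (length (filter (\<lambda>A. w \<in> A) L)) = real (length L) / 2"
      using *(2) that unfolding card unfolding n_def by blast
    then show ?thesis unfolding sum_list_side by linarith
  qed
qed

text \<open>\<open>L\<close> keeps the set constraints of the sum and drops the unit vectors, which
  are nonnegative. A strict summand is either a member of \<open>M\<close>, hence in
  \<open>L\<close>, or a dropped unit vector, which leaves a gap at its point.\<close>

lemma consequences_frame_constraints:
  assumes "p \<in> consequences (frame_constraints W M)"
  shows "\<exists>L. set L \<subseteq> M \<union> blocking W M \<and> (\<forall>w\<in>W. (\<Sum>A\<leftarrow>L. side A w) \<le> fst p w) \<and>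
    (snd p \<longrightarrow> (\<exists>A\<in>set L. A \<in> M) \<or> (\<exists>w\<in>W. (\<Sum>A\<leftarrow>L. side A w) < fst p w))"
  using assms
proof (induction rule: consequences.induct)
  case (base p)
  then consider A where "A \<in> M \<union> blocking W M" "p = (side A, A \<in> M)"
    | w where "w \<in> W" "p = (\<lambda>v. of_bool (v = w), True)"
    by (auto simp: frame_constraints_def)
  then show ?case
  proof cases
    case 1
    then show ?thesis by (intro exI[of _ "[A]"]) auto
  next
    case 2
    then show ?thesis by (intro exI[of _ "[]"]) auto
  qed
next
  case (add a s b t)
  obtain L where L: "set L \<subseteq> M \<union> blocking W M"
      "\<And>w. w \<in> W \<Longrightarrow> (\<Sum>A\<leftarrow>L. side A w) \<le> a w"
      "s \<Longrightarrow> (\<exists>A\<in>set L. A \<in> M) \<or> (\<exists>w\<in>W. (\<Sum>A\<leftarrow>L. side A w) < a w)"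
    using add.IH(1) unfolding fst_conv snd_conv by blast
  obtain L' where L': "set L' \<subseteq> M \<union> blocking W M"
      "\<And>w. w \<in> W \<Longrightarrow> (\<Sum>A\<leftarrow>L'. side A w) \<le> b w"
      "t \<Longrightarrow> (\<exists>A\<in>set L'. A \<in> M) \<or> (\<exists>w\<in>W. (\<Sum>A\<leftarrow>L'. side A w) < b w)"
    using add.IH(2) unfolding fst_conv snd_conv by blast
  have "(\<exists>A\<in>set (L @ L'). A \<in> M) \<or> (\<exists>w\<in>W. (\<Sum>A\<leftarrow>L @ L'. side A w) < a w + b w)" if "s \<or> t"
    using that L(2,3) L'(2,3)
    by (simp add: bex_Un) (meson add_less_le_mono add_le_less_mono)
  then show ?case
    using L(1,2) L'(1,2) by (intro exI[of _ "L @ L'"]) (auto intro: add_mono)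
qed

lemma coherent_no_contradiction:
  assumes "social_decision_frame W M" "coherent_frame W M"
    and "(a, True) \<in> consequences (frame_constraints W M)"
  shows "\<exists>w\<in>W. a w \<noteq> 0"
proof (rule ccontr)
  assume "\<not> ?thesis"
  then have a0: "\<And>w. w \<in> W \<Longrightarrow> a w = 0" by blast
  obtain L where L: "set L \<subseteq> M \<union> blocking W M" "\<And>w. w \<in> W \<Longrightarrow> (\<Sum>A\<leftarrow>L. side A w) \<le> 0"
    "(\<exists>A\<in>set L. A \<in> M) \<or> (\<exists>w\<in>W. (\<Sum>A\<leftarrow>L. side A w) < 0)"
    using consequences_frame_constraints[OF assms(3)] a0 by auto
  \<comment> \<open>Coherence needs a sequence of positive length; the empty list has no member in
    \<open>M\<close>, and its sums are 0.\<close>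
  have "L \<noteq> []" using L(3) by auto
  from coherent_list[OF assms(1,2) this L(1,2)] L(3) show False
    by (fastforce simp: blocking_def)
qed

text \<open>Every point of \<open>W\<close> lies in exactly one of \<open>A\<close> and
  \<open>W - A\<close>, so this sequence of length 2 satisfies (c2), and (c3) makes \<open>A\<close>
  blocking.\<close>

lemma coherent_complement_notin:
  assumes "social_decision_frame W M" "coherent_frame W M" "A \<in> M"
  shows "W - A \<notin> M"
proof
  assume "W - A \<in> M"
  then have "set [A, W - A] \<subseteq> blocking W M"
    using assms by (intro coherent_list(1)[OF assms(1,2)]) (auto simp: side_def)
  then show False using assms(3) by (auto simp: blocking_def)
qed

section \<open>Natural number weights from a rational solution\<close>

lemma coherent_weights:
  assumes "social_decision_frame W M" "coherent_frame W M"
  obtains m :: "'a \<Rightarrow> nat" where "\<And>w. w \<in> W \<Longrightarrow> m w > 0"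
    and "\<And>A. A \<in> M \<Longrightarrow> sum m (W - A) < sum m A"
    and "\<And>A. A \<in> blocking W M \<Longrightarrow> sum m (W - A) \<le> sum m A"
proof -
  have W: "finite W" "M \<subseteq> Pow W" using assms(1) by (auto simp: social_decision_frame_def)
  have "M \<union> blocking W M \<subseteq> Pow W" using W by (auto simp: blocking_def)
  then have "finite (M \<union> blocking W M)"
    by (rule finite_subset) (simp add: W(1))
  then have "finite (frame_constraints W M)"
    unfolding frame_constraints_def using W(1) by blast
  from motzkin_transposition[OF W(1) this coherent_no_contradiction[OF assms]]
  obtain x where x: "\<And>p. p \<in> frame_constraints W M \<Longrightarrow> satisfies W x p" by blast
  obtain k :: nat where k: "k > 0" "\<And>w. w \<in> W \<Longrightarrow> of_nat k * x w \<in> \<int>"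
    using common_denominator[OF W(1), of x] by blast
  have pos: "x w > 0" if "w \<in> W" for w
  proof -
    have "satisfies W x (\<lambda>v. of_bool (v = w), True)"
      using that by (intro x) (auto simp: frame_constraints_def)
    then show ?thesis using W(1) that by (simp add: satisfies_def of_bool_def if_distrib if_distribR sum.delta cong: if_cong)
  qed
  \<comment> \<open>On \<open>W\<close> the product is a positive integer, so neither
    \<open>floor\<close> nor \<open>nat\<close> changes its value.\<close>
  define m where "m w = nat \<lfloor>of_nat k * x w\<rfloor>" for w
  have m: "of_nat (m w) = of_nat k * x w" if "w \<in> W" for w
    using k(2)[OF that] pos[OF that] by (auto simp: m_def elim!: Ints_cases)
  have diff: "of_nat (sum m A) - of_nat (sum m (W - A)) =
      of_nat k * (\<Sum>w\<in>W. of_int (side A w) * x w)" if "A \<subseteq> W" for A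
  proof -
    have "(\<Sum>w\<in>W. of_int (side A w) * x w) = (\<Sum>w\<in>A. x w) - (\<Sum>w\<in>W - A. x w)"
      using sum.subset_diff[OF that W(1), of "\<lambda>w. of_int (side A w) * x w"]
      by (simp add: side_def sum_negf)
    moreover have "of_nat (sum m B) = of_nat k * (\<Sum>w\<in>B. x w)" if "B \<subseteq> W" for B
      using that m by (auto simp: sum_distrib_left intro!: sum.cong)
    ultimately show ?thesis using that by (simp add: right_diff_distrib)
  qed
  show thesis
  proof (rule that[of m])
    fix w assume w: "w \<in> W"
    then have "of_nat (m w) > (0::rat)" using m[OF w] pos[OF w] k(1) by simp
    then show "m w > 0" by simp
  next
    fix A assume A: "A \<in> M"
    then have "satisfies W x (side A, A \<in> M)" by (intro x) (auto simp: frame_constraints_def)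
    then have "of_nat k * (\<Sum>w\<in>W. of_int (side A w) * x w) > 0"
      using A k(1) by (simp add: satisfies_def)
    then have "of_nat (sum m (W - A)) < (of_nat (sum m A) :: rat)"
      using diff[of A] A W(2) by auto
    then show "sum m (W - A) < sum m A" using of_nat_less_iff by blast
  next
    fix A assume A: "A \<in> blocking W M"
    then have "satisfies W x (side A, A \<in> M)" by (intro x) (auto simp: frame_constraints_def)
    then have "of_nat k * (\<Sum>w\<in>W. of_int (side A w) * x w) \<ge> 0"
      using A k(1) by (simp add: satisfies_def blocking_def)
    then have "of_nat (sum m (W - A)) \<le> (of_nat (sum m A) :: rat)"
      using diff[of A] A by (auto simp: blocking_def)
    then show "sum m (W - A) \<le> sum m A" using of_nat_le_iff by blast
  qed
qed

theorem theorem3p7: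
  fixes W :: "'a set" and M :: "'a set set"
  assumes "social_decision_frame W M"
    and "coherent_frame W M"
  shows "measurable_frame W M"
proof -
  obtain m :: "'a \<Rightarrow> nat" where m: "\<And>w. w \<in> W \<Longrightarrow> m w > 0"
      "\<And>A. A \<in> M \<Longrightarrow> sum m (W - A) < sum m A"
      "\<And>A. A \<in> blocking W M \<Longrightarrow> sum m (W - A) \<le> sum m A"
    using coherent_weights[OF assms] by blast
  have W: "finite W" using assms(1) by (simp add: social_decision_frame_def)
  have "additive (Pow W) (sum m)"
    using W by (auto simp: additive_def intro!: sum.union_disjoint intro: finite_subset)
  moreover have "A \<in> M \<longleftrightarrow> real (sum m A) > 1 / 2 * real (sum m W)" if A: "A \<subseteq> W" for A
  proof -
    have "sum m W = sum m (W - A) + sum m A"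
      using sum.subset_diff[OF A W] .
    then have half: "real (sum m A) > 1 / 2 * real (sum m W) \<longleftrightarrow> sum m (W - A) < sum m A"
      by linarith
    \<comment> \<open>The converse direction: if \<open>A\<close> is not in \<open>M\<close>, its
      complement is in \<open>M\<close> or blocking, and so weighs at least as much as
      \<open>A\<close>.\<close>
    have "sum m A \<le> sum m (W - A)" if "A \<notin> M"
    proof (cases "W - A \<in> M")
      case True
      from m(2)[OF this] show ?thesis using A by (simp add: double_diff)
    next
      case False
      then have "W - A \<in> blocking W M" using that A by (simp add: blocking_def double_diff)
      from m(3)[OF this] show ?thesis using A by (simp add: double_diff)
    qed
    then show ?thesis using m(2)[of A] unfolding half by linarith
  qed
  ultimately show ?thesis unfolding measurable_frame_def using m(1)
    by (intro exI[of _ "sum m"]) auto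
qed

end
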